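(* Let $(L,\cdot,[,],\alpha,\beta)$ be a regular BiHom-Poisson algebra over $K$, and consider the ternary operation on $L$ $$[x,y,z]=x\cdot[\beta^{-1}(y),\beta^{-1}(z)]+y\cdot[\alpha^{-1}(z),\alpha\beta^{-2}(x)]+\alpha^{-1}\beta(z)\cdot[\beta^{-1}(x),\alpha\beta^{-2}(y)],\quad x,y,z\in L.$$ If $(L,[\ ,\ ,\ ],\alpha,\beta)$ is a 3-BiHom-Lie algebra, then $(L,\cdot,[\ ,\ ,\ ],\alpha,\beta)$ is a transposed BiHom-Poisson 3-Lie algebra. In particular, if $(L,\cdot,[,],\alpha,\beta)$ is a (regular) strong BiHom-Poisson algebra, then $(L,\cdot,[\ ,\ ,\ ],\alpha,\beta)$ is a transposed BiHom-Poisson 3-Lie algebra.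
   Context: $K$ is a field of characteristic $0$; all vector spaces and linear maps are over $K$. A BiHom-commutative algebra $(L,\cdot,\alpha,\beta)$ is a vector space $L$ with a bilinear product $\cdot$ and linear maps $\alpha,\beta:L\to L$ such that for all $x,y,z$: $\alpha\circ\beta=\beta\circ\alpha$, $\alpha(x\cdot y)=\alpha(x)\cdot\alpha(y)$, $\beta(x\cdot y)=\beta(x)\cdot\beta(y)$, $\alpha(x)\cdot(y\cdot z)=(x\cdot y)\cdot\beta(z)$, and $\beta(x)\cdot\alpha(y)=\beta(y)\cdot\alpha(x)$. A BiHom-Lie algebra $(L,[,],\alpha,\beta)$ is a vector space $L$ with a bilinear bracket and commuting linear maps $\alpha,\beta:L\to L$ such that for all $x,y,z$: $\alpha([x,y])=[\alpha(x),\alpha(y)]$, $\beta([x,y])=[\beta(x),\beta(y)]$, $[\beta(x),\alpha(y)]=-[\beta(y),\alpha(x)]$, and $[[\beta(x),\alpha(y)],\alpha^2(z)]+[[\beta(y),\alpha(z)],\alpha^2(x)]+[[\beta(z),\alpha(x)],\alpha^2(y)]=0$. A BiHom-Poisson algebra is a 5-tuple $(L,\cdot,[,],\alpha,\beta)$ such that $(L,\cdot,\alpha,\beta)$ is a BiHom-commutative algebra, $(L,[,],\alpha,\beta)$ is a BiHom-Lie algebra, and for all $x,y,z$: $[\alpha\beta(x),y\cdot z]=[\beta(x),y]\cdot\beta(z)+\beta(y)\cdot[\alpha(x),z]$. It is regular if $\alpha,\beta$ are invertible, and strong if for all $x,y,z,h\in L$ the sum over cyclic permutations of $x,y,z$ of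 $[\alpha\beta^{3}(x),\alpha^{2}\beta^{2}(y)]\cdot[\alpha^{2}\beta(h),\alpha^{3}\beta(z)]$ is $0$. A 3-BiHom-Lie algebra $(L,[\ ,\ ,\ ],\alpha,\beta)$ is a vector space $L$ with commuting linear maps $\alpha,\beta:L\to L$ and a trilinear map $[\ ,\ ,\ ]$ such that for all $x,y,z,u,v\in L$: (i) $\alpha([x,y,z])=[\alpha(x),\alpha(y),\alpha(z)]$ and $\beta([x,y,z])=[\beta(x),\beta(y),\beta(z)]$; (ii) $[\beta(x),\beta(y),\alpha(z)]=-[\beta(y),\beta(x),\alpha(z)]=-[\beta(x),\beta(z),\alpha(y)]$; (iii) $[\beta^2(u),\beta^2(v),[\beta(x),\beta(y),\alpha(z)]]=[\beta^2(y),\beta^2(z),[\beta(u),\beta(v),\alpha(x)]]-[\beta^2(x),\beta^2(z),[\beta(u),\beta(v),\alpha(y)]]+[\beta^2(x),\beta^2(y),[\beta(u),\beta(v),\alpha(z)]]$. A transposed BiHom-Poisson 3-Lie algebra is a 5-tuple $(L,\cdot,[\ ,\ ,\ ],\alpha,\beta)$ where $(L,\cdot,\alpha,\beta)$ is a BiHom-commutative algebra, $(L,[\ ,\ ,\ ],\alpha,\beta)$ is a 3-BiHom-Lie algebra, and for all $u,x,y,z$: $3\alpha\beta(u)\cdot[x,y,z]=[\beta(u)\cdot x,\beta(y),\beta(z)]+[\beta(x),\beta(u)\cdot y,\beta(z)]+[\beta(x),\beta(y),\alpha(u)\cdot z]$. *)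

theory Defs
  imports Complex_Main
begin

definition bilinear_map ::
  "('k::field \<Rightarrow> 'l::ab_group_add \<Rightarrow> 'l) \<Rightarrow> ('l \<Rightarrow> 'l \<Rightarrow> 'l) \<Rightarrow> bool" where
  "bilinear_map scale f \<longleftrightarrow>
     (\<forall>y. Vector_Spaces.linear scale scale (\<lambda>x. f x y)) \<and>
     (\<forall>x. Vector_Spaces.linear scale scale (\<lambda>y. f x y))"

definition trilinear_map ::
  "('k::field \<Rightarrow> 'l::ab_group_add \<Rightarrow> 'l) \<Rightarrow> ('l \<Rightarrow> 'l \<Rightarrow> 'l \<Rightarrow> 'l) \<Rightarrow> bool" where
  "trilinear_map scale f \<longleftrightarrow>
     (\<forall>y z. Vector_Spaces.linear scale scale (\<lambda>x. f x y z)) \<and>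
     (\<forall>x z. Vector_Spaces.linear scale scale (\<lambda>y. f x y z)) \<and>
     (\<forall>x y. Vector_Spaces.linear scale scale (\<lambda>z. f x y z))"

text \<open>The underlying vector space is the whole type \<open>'l\<close>, with scalar multiplication \<open>scale\<close> over
  a field of characteristic 0.\<close>

locale bihom_space = vector_space scale
  for scale :: "'k::field_char_0 \<Rightarrow> 'l::ab_group_add \<Rightarrow> 'l"
    and \<alpha> \<beta> :: "'l \<Rightarrow> 'l" +
  assumes linear_\<alpha>: "Vector_Spaces.linear scale scale \<alpha>"
    and linear_\<beta>: "Vector_Spaces.linear scale scale \<beta>"
    and \<alpha>_\<beta>_commute: "\<alpha> \<circ> \<beta> = \<beta> \<circ> \<alpha>"

locale bihom_commutative_algebra = bihom_space scale \<alpha> \<beta>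
  for scale :: "'k::field_char_0 \<Rightarrow> 'l::ab_group_add \<Rightarrow> 'l"
    and mult :: "'l \<Rightarrow> 'l \<Rightarrow> 'l"  (infixl "\<odot>" 70)
    and \<alpha> \<beta> :: "'l \<Rightarrow> 'l" +
  assumes bilinear_mult: "bilinear_map scale mult"
    and \<alpha>_mult: "\<alpha> (x \<odot> y) = \<alpha> x \<odot> \<alpha> y"
    and \<beta>_mult: "\<beta> (x \<odot> y) = \<beta> x \<odot> \<beta> y"
    and bihom_assoc: "\<alpha> x \<odot> (y \<odot> z) = (x \<odot> y) \<odot> \<beta> z"
    and bihom_commute: "\<beta> x \<odot> \<alpha> y = \<beta> y \<odot> \<alpha> x"

locale bihom_lie_algebra = bihom_space scale \<alpha> \<beta>
  for scale :: "'k::field_char_0 \<Rightarrow> 'l::ab_group_add \<Rightarrow> 'l"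
    and br :: "'l \<Rightarrow> 'l \<Rightarrow> 'l"
    and \<alpha> \<beta> :: "'l \<Rightarrow> 'l" +
  assumes bilinear_br: "bilinear_map scale br"
    and \<alpha>_br: "\<alpha> (br x y) = br (\<alpha> x) (\<alpha> y)"
    and \<beta>_br: "\<beta> (br x y) = br (\<beta> x) (\<beta> y)"
    and bihom_skew: "br (\<beta> x) (\<alpha> y) = - br (\<beta> y) (\<alpha> x)"
    and bihom_jacobi:
      "br (br (\<beta> x) (\<alpha> y)) ((\<alpha> ^^ 2) z) + br (br (\<beta> y) (\<alpha> z)) ((\<alpha> ^^ 2) x)
        + br (br (\<beta> z) (\<alpha> x)) ((\<alpha> ^^ 2) y) = 0"

locale bihom_poisson_algebra =
  bihom_commutative_algebra scale mult \<alpha> \<beta> + bihom_lie_algebra scale br \<alpha> \<beta>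
  for scale :: "'k::field_char_0 \<Rightarrow> 'l::ab_group_add \<Rightarrow> 'l"
    and mult :: "'l \<Rightarrow> 'l \<Rightarrow> 'l"  (infixl "\<odot>" 70)
    and br :: "'l \<Rightarrow> 'l \<Rightarrow> 'l"
    and \<alpha> \<beta> :: "'l \<Rightarrow> 'l" +
  assumes bihom_leibniz: "br (\<alpha> (\<beta> x)) (y \<odot> z) = br (\<beta> x) y \<odot> \<beta> z + \<beta> y \<odot> br (\<alpha> x) z"

locale regular_bihom_poisson_algebra = bihom_poisson_algebra scale mult br \<alpha> \<beta>
  for scale :: "'k::field_char_0 \<Rightarrow> 'l::ab_group_add \<Rightarrow> 'l"
    and mult :: "'l \<Rightarrow> 'l \<Rightarrow> 'l"  (infixl "\<odot>" 70)
    and br :: "'l \<Rightarrow> 'l \<Rightarrow> 'l"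
    and \<alpha> \<beta> :: "'l \<Rightarrow> 'l" +
  assumes bij_\<alpha>: "bij \<alpha>" and bij_\<beta>: "bij \<beta>"

locale strong_bihom_poisson_algebra = bihom_poisson_algebra scale mult br \<alpha> \<beta>
  for scale :: "'k::field_char_0 \<Rightarrow> 'l::ab_group_add \<Rightarrow> 'l"
    and mult :: "'l \<Rightarrow> 'l \<Rightarrow> 'l"  (infixl "\<odot>" 70)
    and br :: "'l \<Rightarrow> 'l \<Rightarrow> 'l"
    and \<alpha> \<beta> :: "'l \<Rightarrow> 'l" +
  assumes strong:
    "br (\<alpha> ((\<beta> ^^ 3) x)) ((\<alpha> ^^ 2) ((\<beta> ^^ 2) y)) \<odot> br ((\<alpha> ^^ 2) (\<beta> h)) ((\<alpha> ^^ 3) (\<beta> z))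
      + br (\<alpha> ((\<beta> ^^ 3) y)) ((\<alpha> ^^ 2) ((\<beta> ^^ 2) z)) \<odot> br ((\<alpha> ^^ 2) (\<beta> h)) ((\<alpha> ^^ 3) (\<beta> x))
      + br (\<alpha> ((\<beta> ^^ 3) z)) ((\<alpha> ^^ 2) ((\<beta> ^^ 2) x)) \<odot> br ((\<alpha> ^^ 2) (\<beta> h)) ((\<alpha> ^^ 3) (\<beta> y)) = 0"

locale three_bihom_lie_algebra = bihom_space scale \<alpha> \<beta>
  for scale :: "'k::field_char_0 \<Rightarrow> 'l::ab_group_add \<Rightarrow> 'l"
    and tbr :: "'l \<Rightarrow> 'l \<Rightarrow> 'l \<Rightarrow> 'l"
    and \<alpha> \<beta> :: "'l \<Rightarrow> 'l" +
  assumes trilinear_tbr: "trilinear_map scale tbr"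
    and \<alpha>_tbr: "\<alpha> (tbr x y z) = tbr (\<alpha> x) (\<alpha> y) (\<alpha> z)"
    and \<beta>_tbr: "\<beta> (tbr x y z) = tbr (\<beta> x) (\<beta> y) (\<beta> z)"
    and tbr_skew12: "tbr (\<beta> x) (\<beta> y) (\<alpha> z) = - tbr (\<beta> y) (\<beta> x) (\<alpha> z)"
    and tbr_skew23: "tbr (\<beta> x) (\<beta> y) (\<alpha> z) = - tbr (\<beta> x) (\<beta> z) (\<alpha> y)"
    and tbr_jacobi:
      "tbr ((\<beta> ^^ 2) u) ((\<beta> ^^ 2) v) (tbr (\<beta> x) (\<beta> y) (\<alpha> z)) =
         tbr ((\<beta> ^^ 2) y) ((\<beta> ^^ 2) z) (tbr (\<beta> u) (\<beta> v) (\<alpha> x))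
         - tbr ((\<beta> ^^ 2) x) ((\<beta> ^^ 2) z) (tbr (\<beta> u) (\<beta> v) (\<alpha> y))
         + tbr ((\<beta> ^^ 2) x) ((\<beta> ^^ 2) y) (tbr (\<beta> u) (\<beta> v) (\<alpha> z))"

locale transposed_bihom_poisson_three_lie_algebra =
  bihom_commutative_algebra scale mult \<alpha> \<beta> + three_bihom_lie_algebra scale tbr \<alpha> \<beta>
  for scale :: "'k::field_char_0 \<Rightarrow> 'l::ab_group_add \<Rightarrow> 'l"
    and mult :: "'l \<Rightarrow> 'l \<Rightarrow> 'l"  (infixl "\<odot>" 70)
    and tbr :: "'l \<Rightarrow> 'l \<Rightarrow> 'l \<Rightarrow> 'l"
    and \<alpha> \<beta> :: "'l \<Rightarrow> 'l" +
  assumes transposed_leibniz: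
    "scale 3 (\<alpha> (\<beta> u)) \<odot> tbr x y z =
       tbr (\<beta> u \<odot> x) (\<beta> y) (\<beta> z) + tbr (\<beta> x) (\<beta> u \<odot> y) (\<beta> z)
       + tbr (\<beta> x) (\<beta> y) (\<alpha> u \<odot> z)"

text \<open>Meaningful only for bijective \<open>\<alpha>\<close> and \<open>\<beta>\<close>, where \<open>inv\<close> is the actual inverse.\<close>

definition induced_tbr ::
  "('l \<Rightarrow> 'l \<Rightarrow> 'l) \<Rightarrow> ('l \<Rightarrow> 'l \<Rightarrow> 'l) \<Rightarrow> ('l \<Rightarrow> 'l) \<Rightarrow> ('l \<Rightarrow> 'l) \<Rightarrow>
     'l \<Rightarrow> 'l \<Rightarrow> 'l \<Rightarrow> 'l::ab_group_add" where
  "induced_tbr mult br \<alpha> \<beta> x y z =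
     mult x (br (inv \<beta> y) (inv \<beta> z))
     + mult y (br (inv \<alpha> z) (\<alpha> ((inv \<beta> ^^ 2) x)))
     + mult (inv \<alpha> (\<beta> z)) (br (inv \<beta> x) (\<alpha> ((inv \<beta> ^^ 2) y)))"

end

theory Submission
  imports Defs
begin

text \<open>
  The twisting maps can be removed. Since \<open>\<alpha>\<close> and \<open>\<beta>\<close> are bijective, put
  \<open>x \<bullet> y = \<alpha>\<^sup>-\<^sup>1 x \<odot> \<beta>\<^sup>-\<^sup>1 y\<close> and \<open>\<lbrace>x, y\<rbrace> = br (\<alpha>\<^sup>-\<^sup>1 x) (\<beta>\<^sup>-\<^sup>1 y)\<close>, so that
  \<open>x \<odot> y = \<alpha> x \<bullet> \<beta> y\<close> and \<open>br x y = \<lbrace>\<alpha> x, \<beta> y\<rbrace>\<close>. The maps \<open>\<alpha>\<close> and \<open>\<beta>\<close> commute and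
  respect both operations, so every BiHom axiom becomes the corresponding axiom of an ordinary
  Poisson algebra, evaluated at elements of the form \<open>\<alpha>\<^sup>m \<beta>\<^sup>n x\<close>; these are arbitrary
  elements (\<open>poisson_ring_untwisted\<close>). The ternary operation becomes
  \<open>[x, y, z] = T(\<alpha> x, \<alpha> y, \<beta> z)\<close> with the alternating expression
  \<open>T(a, b, c) = a \<bullet> \<lbrace>b, c\<rbrace> + b \<bullet> \<lbrace>c, a\<rbrace> + c \<bullet> \<lbrace>a, b\<rbrace>\<close> (\<open>tbr_eq_triple\<close>).

  It remains to prove two facts about ordinary Poisson algebras.
  The transposed Leibniz rule \<open>3u \<bullet> T(a, b, c) = T(u \<bullet> a, b, c) + T(a, u \<bullet> b, c) + T(a, b, u \<bullet> c)\<close>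
  follows from the Poisson axioms: expanding the brackets by the Leibniz rule, the terms in which \<open>u\<close> is
  differentiated cancel in pairs (\<open>triple_transposed_leibniz\<close>).
  The Filippov identity, which says that \<open>T(u, v, _)\<close> is a derivation of \<open>T\<close>, uses the strong
  condition. Write \<open>T(u, v, _) = H + p\<close>, where \<open>p = \<lbrace>u, v\<rbrace>\<close> acts by multiplication and
  \<open>H = u \<bullet> \<lbrace>v, _\<rbrace> - v \<bullet> \<lbrace>u, _\<rbrace>\<close> is a derivation of the product. On a bracket \<open>\<lbrace>b, c\<rbrace>\<close> the
  operator \<open>H\<close> fails the Leibniz rule by
  \<open>2(\<lbrace>u, b\<rbrace> \<bullet> \<lbrace>v, c\<rbrace> - \<lbrace>u, c\<rbrace> \<bullet> \<lbrace>v, b\<rbrace>)\<close>, which the strong condition identifies with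
  \<open>2p \<bullet> \<lbrace>b, c\<rbrace>\<close>. Hence \<open>H\<close> fails on \<open>T\<close> by \<open>2p \<bullet> T\<close>, whereas by the transposed Leibniz
  rule the multiplication by \<open>p\<close> fails by \<open>p \<bullet> T - 3p \<bullet> T = -2p \<bullet> T\<close>, and the two defects
  cancel (\<open>triple_filippov\<close>).
\<close>

section \<open>Poisson rings and the alternating triple bracket\<close>

text \<open>The scalar \<open>3\<close> of the transposed Leibniz rule is read as a threefold sum, so the rule makes
  sense over any abelian group.\<close>

locale poisson_ring =
  fixes pr :: "'a::ab_group_add \<Rightarrow> 'a \<Rightarrow> 'a"  (infixl "\<bullet>" 70)
    and pb :: "'a \<Rightarrow> 'a \<Rightarrow> 'a"  ("\<lbrace>_, _\<rbrace>")
  assumes pr_add_left: "(a + b) \<bullet> c = a \<bullet> c + b \<bullet> c"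
    and pr_commute: "a \<bullet> b = b \<bullet> a"
    and pr_assoc: "(a \<bullet> b) \<bullet> c = a \<bullet> (b \<bullet> c)"
    and pb_add_left: "\<lbrace>a + b, c\<rbrace> = \<lbrace>a, c\<rbrace> + \<lbrace>b, c\<rbrace>"
    and pb_skew: "\<lbrace>a, b\<rbrace> = - \<lbrace>b, a\<rbrace>"
    and pb_jacobi: "\<lbrace>\<lbrace>a, b\<rbrace>, c\<rbrace> + \<lbrace>\<lbrace>b, c\<rbrace>, a\<rbrace> + \<lbrace>\<lbrace>c, a\<rbrace>, b\<rbrace> = 0"
    and pb_leibniz: "\<lbrace>a, b \<bullet> c\<rbrace> = \<lbrace>a, b\<rbrace> \<bullet> c + b \<bullet> \<lbrace>a, c\<rbrace>"
begin

lemma pr_add_right: "a \<bullet> (b + c) = a \<bullet> b + a \<bullet> c"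
  by (metis pr_add_left pr_commute)

lemma pr_left_commute: "a \<bullet> (b \<bullet> c) = b \<bullet> (a \<bullet> c)"
  by (metis pr_assoc pr_commute)

lemma pb_add_right: "\<lbrace>a, b + c\<rbrace> = \<lbrace>a, b\<rbrace> + \<lbrace>a, c\<rbrace>"
  by (metis pb_add_left pb_skew minus_add_distrib)

lemma pr_minus_left: "(- a) \<bullet> b = - (a \<bullet> b)"
  by (metis pr_add_left add_cancel_right_right add.right_inverse eq_neg_iff_add_eq_0 add.commute)

lemma pr_minus_right: "a \<bullet> (- b) = - (a \<bullet> b)"
  by (metis pr_commute pr_minus_left)

lemma pb_minus_left: "\<lbrace>- a, b\<rbrace> = - \<lbrace>a, b\<rbrace>"
  by (metis pb_add_left add_cancel_right_right add.right_inverse eq_neg_iff_add_eq_0 add.commute)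

lemma pb_minus_right: "\<lbrace>a, - b\<rbrace> = - \<lbrace>a, b\<rbrace>"
  by (metis pb_skew pb_minus_left)

lemma pr_diff_left: "(a - b) \<bullet> c = a \<bullet> c - b \<bullet> c"
  using pr_add_left[of a "- b" c] by (simp add: pr_minus_left)

lemma pr_diff_right: "a \<bullet> (b - c) = a \<bullet> b - a \<bullet> c"
  using pr_diff_left by (metis pr_commute)

lemma pb_diff_left: "\<lbrace>a - b, c\<rbrace> = \<lbrace>a, c\<rbrace> - \<lbrace>b, c\<rbrace>"
  using pb_add_left[of a "- b" c] by (simp add: pb_minus_left)

lemma pb_diff_right: "\<lbrace>a, b - c\<rbrace> = \<lbrace>a, b\<rbrace> - \<lbrace>a, c\<rbrace>"
  using pb_add_right[of a b "- c"] by (simp add: pb_minus_right)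

lemma pb_leibniz_left: "\<lbrace>a \<bullet> b, c\<rbrace> = a \<bullet> \<lbrace>b, c\<rbrace> + b \<bullet> \<lbrace>a, c\<rbrace>"
proof -
  have "\<lbrace>a \<bullet> b, c\<rbrace> = - (\<lbrace>c, a\<rbrace> \<bullet> b + a \<bullet> \<lbrace>c, b\<rbrace>)"
    by (metis pb_skew pb_leibniz)
  also have "\<dots> = a \<bullet> \<lbrace>b, c\<rbrace> + b \<bullet> \<lbrace>a, c\<rbrace>"
    by (simp add: pb_skew[of c] pr_commute[of _ b] pr_minus_right)
  finally show ?thesis .
qed

lemma pb_jacobi_derivation: "\<lbrace>a, \<lbrace>b, c\<rbrace>\<rbrace> = \<lbrace>\<lbrace>a, b\<rbrace>, c\<rbrace> + \<lbrace>b, \<lbrace>a, c\<rbrace>\<rbrace>"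
proof -
  have "\<lbrace>a, \<lbrace>b, c\<rbrace>\<rbrace> = - \<lbrace>\<lbrace>b, c\<rbrace>, a\<rbrace>" by (rule pb_skew)
  also have "\<dots> = \<lbrace>\<lbrace>a, b\<rbrace>, c\<rbrace> + \<lbrace>\<lbrace>c, a\<rbrace>, b\<rbrace>"
    using pb_jacobi[of a b c] by (intro minus_unique) (simp add: ac_simps)
  also have "\<lbrace>\<lbrace>c, a\<rbrace>, b\<rbrace> = \<lbrace>b, \<lbrace>a, c\<rbrace>\<rbrace>"
    by (metis pb_skew pb_minus_left)
  finally show ?thesis .
qed

text \<open>For the bracket \<open>\<lbrace>a, b\<rbrace> = D\<^sub>1 a \<bullet> D\<^sub>2 b - D\<^sub>2 a \<bullet> D\<^sub>1 b\<close> of two commuting derivations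
  this is the determinant of the \<open>3 \<times> 3\<close> matrix with rows \<open>a, D\<^sub>1 a, D\<^sub>2 a\<close> and likewise for
  \<open>b\<close> and \<open>c\<close>.\<close>

definition triple :: "'a \<Rightarrow> 'a \<Rightarrow> 'a \<Rightarrow> 'a"
  where "triple a b c = a \<bullet> \<lbrace>b, c\<rbrace> + b \<bullet> \<lbrace>c, a\<rbrace> + c \<bullet> \<lbrace>a, b\<rbrace>"

lemma triple_skew12: "triple a b c = - triple b a c"
  using pb_skew[of b c] pb_skew[of c a] pb_skew[of a b]
  by (simp add: triple_def pr_minus_right algebra_simps)

lemma triple_cyclic: "triple a b c = triple b c a"
  by (simp add: triple_def algebra_simps)

lemma triple_skew23: "triple a b c = - triple a c b"
  by (metis triple_skew12 triple_cyclic)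

lemma triple_add_first: "triple (a + a') b c = triple a b c + triple a' b c"
  by (simp add: triple_def pr_add_left pr_add_right pb_add_left pb_add_right algebra_simps)

lemma triple_mult_first:
  "triple (u \<bullet> a) b c = u \<bullet> triple a b c + (a \<bullet> c) \<bullet> \<lbrace>u, b\<rbrace> - (a \<bullet> b) \<bullet> \<lbrace>u, c\<rbrace>"
  using pb_skew[of c u]
  by (simp add: triple_def pr_add_right pb_leibniz pb_leibniz_left pr_assoc pr_commute pr_left_commute
      pr_minus_right pr_diff_right algebra_simps)

text \<open>In the sum every correction term of \<open>triple_mult_first\<close> occurs twice, with opposite signs.\<close>

theorem triple_transposed_leibniz:
  "triple (u \<bullet> a) b c + triple a (u \<bullet> b) c + triple a b (u \<bullet> c)
     = u \<bullet> triple a b c + u \<bullet> triple a b c + u \<bullet> triple a b c"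
proof -
  have "triple a (u \<bullet> b) c = u \<bullet> triple a b c + (a \<bullet> b) \<bullet> \<lbrace>u, c\<rbrace> - (b \<bullet> c) \<bullet> \<lbrace>u, a\<rbrace>"
    using triple_mult_first[of u b c a] by (metis triple_cyclic pr_commute)
  moreover have "triple a b (u \<bullet> c) = u \<bullet> triple a b c + (b \<bullet> c) \<bullet> \<lbrace>u, a\<rbrace> - (a \<bullet> c) \<bullet> \<lbrace>u, b\<rbrace>"
    using triple_mult_first[of u c a b] by (metis triple_cyclic pr_commute)
  ultimately show ?thesis
    by (simp add: triple_mult_first)
qed

end

section \<open>The Filippov identity for strong Poisson rings\<close>

locale strong_poisson_ring = poisson_ring +
  assumes pb_strong: "\<lbrace>a, b\<rbrace> \<bullet> \<lbrace>h, c\<rbrace> + \<lbrace>b, c\<rbrace> \<bullet> \<lbrace>h, a\<rbrace> + \<lbrace>c, a\<rbrace> \<bullet> \<lbrace>h, b\<rbrace> = 0"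
begin

text \<open>The strong condition says that \<open>\<lbrace>_, _\<rbrace>\<close> satisfies the quadratic relation of the
  Pluecker coordinates of a line; this is the form in which it enters the Filippov identity.\<close>

lemma pluecker: "\<lbrace>u, v\<rbrace> \<bullet> \<lbrace>b, c\<rbrace> = \<lbrace>u, b\<rbrace> \<bullet> \<lbrace>v, c\<rbrace> - \<lbrace>u, c\<rbrace> \<bullet> \<lbrace>v, b\<rbrace>"
  using pb_strong[of b c u v] pb_skew[of c v]
  by (simp add: pr_minus_left pr_commute[of "\<lbrace>b, c\<rbrace>"] pr_commute[of "\<lbrace>v, _\<rbrace>"] algebra_simps)

text \<open>The first-order part of \<open>triple u v\<close>. It is a derivation of the product, being a combination
  of the derivations \<open>\<lbrace>v, _\<rbrace>\<close> and \<open>\<lbrace>u, _\<rbrace>\<close>.\<close>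

definition ham :: "'a \<Rightarrow> 'a \<Rightarrow> 'a \<Rightarrow> 'a"
  where "ham u v a = u \<bullet> \<lbrace>v, a\<rbrace> - v \<bullet> \<lbrace>u, a\<rbrace>"

lemma triple_eq_ham: "triple u v a = ham u v a + \<lbrace>u, v\<rbrace> \<bullet> a"
  using pb_skew[of a u] pr_commute[of a] by (simp add: triple_def ham_def pr_minus_right)

lemma ham_add: "ham u v (a + b) = ham u v a + ham u v b"
  by (simp add: ham_def pr_add_right pb_add_right)

lemma ham_mult: "ham u v (a \<bullet> b) = ham u v a \<bullet> b + a \<bullet> ham u v b"
  by (simp add: ham_def pb_leibniz pr_add_right pr_diff_left pr_diff_right pr_assoc
      pr_left_commute algebra_simps)

text \<open>The defect of the Leibniz rule is twice
  \<^term>\<open>\<lbrace>u, b\<rbrace> \<bullet> \<lbrace>v, c\<rbrace> - \<lbrace>u, c\<rbrace> \<bullet> \<lbrace>v, b\<rbrace>\<close>: each of the first two terms on the right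
  contains its negative once, coming from the bracket differentiating the coefficients \<open>u\<close> and
  \<open>v\<close> of \<open>ham u v\<close>, and the second derivatives cancel by the Jacobi identity. The three-term
  relation turns the defect into a multiple of the bracket itself.\<close>

lemma ham_bracket:
  "ham u v \<lbrace>b, c\<rbrace> = \<lbrace>ham u v b, c\<rbrace> + \<lbrace>b, ham u v c\<rbrace>
     + \<lbrace>u, v\<rbrace> \<bullet> \<lbrace>b, c\<rbrace> + \<lbrace>u, v\<rbrace> \<bullet> \<lbrace>b, c\<rbrace>"
proof -
  have first: "\<lbrace>ham u v b, c\<rbrace> = u \<bullet> \<lbrace>\<lbrace>v, b\<rbrace>, c\<rbrace> + \<lbrace>v, b\<rbrace> \<bullet> \<lbrace>u, c\<rbrace>
      - v \<bullet> \<lbrace>\<lbrace>u, b\<rbrace>, c\<rbrace> - \<lbrace>u, b\<rbrace> \<bullet> \<lbrace>v, c\<rbrace>"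
    by (simp add: ham_def pb_leibniz_left pb_diff_left algebra_simps)
  have second: "\<lbrace>b, ham u v c\<rbrace> = u \<bullet> \<lbrace>b, \<lbrace>v, c\<rbrace>\<rbrace> - \<lbrace>u, b\<rbrace> \<bullet> \<lbrace>v, c\<rbrace>
      - v \<bullet> \<lbrace>b, \<lbrace>u, c\<rbrace>\<rbrace> + \<lbrace>v, b\<rbrace> \<bullet> \<lbrace>u, c\<rbrace>"
    using pb_skew[of b u] pb_skew[of b v]
    by (simp add: ham_def pb_leibniz pb_diff_right pr_minus_left algebra_simps)
  have whole: "ham u v \<lbrace>b, c\<rbrace> = u \<bullet> \<lbrace>\<lbrace>v, b\<rbrace>, c\<rbrace> + u \<bullet> \<lbrace>b, \<lbrace>v, c\<rbrace>\<rbrace>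
      - v \<bullet> \<lbrace>\<lbrace>u, b\<rbrace>, c\<rbrace> - v \<bullet> \<lbrace>b, \<lbrace>u, c\<rbrace>\<rbrace>"
    by (simp add: ham_def pb_jacobi_derivation[of _ b c] pr_add_right algebra_simps)
  show ?thesis
    unfolding first second whole
    by (simp add: pluecker[of u v b c] pr_commute[of "\<lbrace>v, b\<rbrace>" "\<lbrace>u, c\<rbrace>"] algebra_simps)
qed

text \<open>Each summand of the triple bracket is a product of an element and a bracket, and only the
  bracket factor contributes the defect of \<open>ham_bracket\<close>.\<close>

lemma ham_triple:
  "ham u v (triple a b c) = triple (ham u v a) b c + triple a (ham u v b) c + triple a b (ham u v c)
     + \<lbrace>u, v\<rbrace> \<bullet> triple a b c + \<lbrace>u, v\<rbrace> \<bullet> triple a b c"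
  by (simp add: triple_def ham_add ham_mult ham_bracket pr_add_right pr_left_commute[of "\<lbrace>u, v\<rbrace>"]
      algebra_simps)

lemma triple_add_second: "triple a (b + b') c = triple a b c + triple a b' c"
  by (metis triple_cyclic triple_add_first)

lemma triple_add_third: "triple a b (c + c') = triple a b c + triple a b c'"
  by (metis triple_cyclic triple_add_first)

text \<open>Write \<open>triple u v = ham u v + M\<close> with \<open>M\<close> the multiplication by \<open>p = \<lbrace>u, v\<rbrace>\<close>. On the
  left \<open>ham u v\<close> exceeds its derivation value by \<open>2p \<bullet> triple a b c\<close> and \<open>M\<close> adds one more copy;
  on the right the three occurrences of \<open>M\<close> add up to \<open>3p \<bullet> triple a b c\<close>, by the transposed
  Leibniz rule. So the two sides agree.\<close>

theorem triple_filippov: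
  "triple u v (triple a b c) =
     triple (triple u v a) b c + triple a (triple u v b) c + triple a b (triple u v c)"
  using triple_transposed_leibniz[of "\<lbrace>u, v\<rbrace>" a b c]
  by (simp add: triple_eq_ham[of u v] ham_triple triple_add_first triple_add_second triple_add_third
      algebra_simps)

end

section \<open>Untwisting a regular BiHom-Poisson algebra\<close>

lemma bilinear_mapD:
  assumes "bilinear_map scale f"
  shows "f (x + x') y = f x y + f x' y" "f x (y + y') = f x y + f x y'"
    "f (scale r x) y = scale r (f x y)" "f x (scale r y) = scale r (f x y)"
  using assms
  by (auto simp: bilinear_map_def Vector_Spaces.linear_iff)

context regular_bihom_poisson_algebra
begin

lemma hom_add: "\<alpha> (x + y) = \<alpha> x + \<alpha> y" "\<beta> (x + y) = \<beta> x + \<beta> y"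
  using linear_\<alpha> linear_\<beta> by (auto simp: Vector_Spaces.linear_iff)

lemma hom_scale: "\<alpha> (scale r x) = scale r (\<alpha> x)" "\<beta> (scale r x) = scale r (\<beta> x)"
  using linear_\<alpha> linear_\<beta> by (auto simp: Vector_Spaces.linear_iff)

lemma \<alpha>\<beta>: "\<alpha> (\<beta> x) = \<beta> (\<alpha> x)"
  using \<alpha>_\<beta>_commute by (metis comp_apply)

lemma inv_cancel [simp]:
  "inv \<alpha> (\<alpha> x) = x" "\<alpha> (inv \<alpha> x) = x" "inv \<beta> (\<beta> x) = x" "\<beta> (inv \<beta> x) = x"
  using bij_\<alpha> bij_\<beta> by (simp_all add: bij_is_inj bij_is_surj surj_f_inv_f)

lemma inv_\<beta>_\<alpha>: "inv \<beta> (\<alpha> x) = \<alpha> (inv \<beta> x)"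
  by (metis \<alpha>\<beta> inv_cancel(3,4))

lemma inv_\<alpha>_\<beta>: "inv \<alpha> (\<beta> x) = \<beta> (inv \<alpha> x)"
  by (metis \<alpha>\<beta> inv_cancel(1,2))

definition umult :: "'l \<Rightarrow> 'l \<Rightarrow> 'l"  (infixl "\<bullet>" 70)
  where "x \<bullet> y = inv \<alpha> x \<odot> inv \<beta> y"

definition ubr :: "'l \<Rightarrow> 'l \<Rightarrow> 'l"  ("\<lbrace>_, _\<rbrace>")
  where "\<lbrace>x, y\<rbrace> = br (inv \<alpha> x) (inv \<beta> y)"

lemma twist: "x \<odot> y = \<alpha> x \<bullet> \<beta> y" "br x y = \<lbrace>\<alpha> x, \<beta> y\<rbrace>"
  by (simp_all add: umult_def ubr_def)

lemma hom_untwisted: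
  "\<alpha> (x \<bullet> y) = \<alpha> x \<bullet> \<alpha> y" "\<beta> (x \<bullet> y) = \<beta> x \<bullet> \<beta> y"
  "\<alpha> \<lbrace>x, y\<rbrace> = \<lbrace>\<alpha> x, \<alpha> y\<rbrace>" "\<beta> \<lbrace>x, y\<rbrace> = \<lbrace>\<beta> x, \<beta> y\<rbrace>"
  by (simp_all add: umult_def ubr_def \<alpha>_mult \<beta>_mult \<alpha>_br \<beta>_br inv_\<alpha>_\<beta> inv_\<beta>_\<alpha>)

lemma inv_add: "inv \<alpha> (x + y) = inv \<alpha> x + inv \<alpha> y" "inv \<beta> (x + y) = inv \<beta> x + inv \<beta> y"
  by (metis hom_add inv_cancel)+

lemma inv_scale: "inv \<alpha> (scale r x) = scale r (inv \<alpha> x)" "inv \<beta> (scale r x) = scale r (inv \<beta> x)"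
  by (metis hom_scale inv_cancel)+

text \<open>The untwisted axioms come from the BiHom axioms at suitable preimages; the exponents in each
  use below are the powers of \<open>\<alpha>\<close> and \<open>\<beta>\<close> that the corresponding axiom puts on its variables
  after rewriting with \<open>twist\<close>.\<close>

lemma ex_preimage: "\<exists>x. a = (\<alpha> ^^ m) ((\<beta> ^^ n) x)"
proof -
  have "surj (\<alpha> ^^ m)" "surj (\<beta> ^^ n)"
    using bij_\<alpha> bij_\<beta> by (simp_all add: bij_is_surj surj_fn)
  then show ?thesis by (metis surjD)
qed

lemma poisson_ring_untwisted: "poisson_ring umult ubr"
proof
  fix a b c
  show "(a + b) \<bullet> c = a \<bullet> c + b \<bullet> c" "\<lbrace>a + b, c\<rbrace> = \<lbrace>a, c\<rbrace> + \<lbrace>b, c\<rbrace>"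
    by (simp_all add: umult_def ubr_def inv_add bilinear_mapD[OF bilinear_mult]
        bilinear_mapD[OF bilinear_br])
  obtain x y where "a = (\<alpha> ^^ 1) ((\<beta> ^^ 1) x)" "b = (\<alpha> ^^ 1) ((\<beta> ^^ 1) y)"
    using ex_preimage by metis
  then show "a \<bullet> b = b \<bullet> a" "\<lbrace>a, b\<rbrace> = - \<lbrace>b, a\<rbrace>"
    using bihom_commute[of x y] bihom_skew[of x y] by (simp_all add: twist \<alpha>\<beta>)
  obtain x y z where "a = (\<alpha> ^^ 2) ((\<beta> ^^ 0) x)" "b = (\<alpha> ^^ 1) ((\<beta> ^^ 1) y)" "c = (\<alpha> ^^ 0) ((\<beta> ^^ 2) z)"
    using ex_preimage by metis
  then show "(a \<bullet> b) \<bullet> c = a \<bullet> (b \<bullet> c)"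
    using bihom_assoc[of x y z] by (simp add: twist \<alpha>\<beta> hom_untwisted numeral_2_eq_2)
  obtain x y z where "a = (\<alpha> ^^ 2) ((\<beta> ^^ 1) x)" "b = (\<alpha> ^^ 2) ((\<beta> ^^ 1) y)" "c = (\<alpha> ^^ 2) ((\<beta> ^^ 1) z)"
    using ex_preimage by metis
  then show "\<lbrace>\<lbrace>a, b\<rbrace>, c\<rbrace> + \<lbrace>\<lbrace>b, c\<rbrace>, a\<rbrace> + \<lbrace>\<lbrace>c, a\<rbrace>, b\<rbrace> = 0"
    using bihom_jacobi[of x y z] by (simp add: twist \<alpha>\<beta> hom_untwisted numeral_2_eq_2)
  obtain x y z where "a = (\<alpha> ^^ 2) ((\<beta> ^^ 1) x)" "b = (\<alpha> ^^ 1) ((\<beta> ^^ 1) y)" "c = (\<alpha> ^^ 0) ((\<beta> ^^ 2) z)"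
    using ex_preimage by metis
  then show "\<lbrace>a, b \<bullet> c\<rbrace> = \<lbrace>a, b\<rbrace> \<bullet> c + b \<bullet> \<lbrace>a, c\<rbrace>"
    using bihom_leibniz[of x y z] by (simp add: twist \<alpha>\<beta> hom_untwisted numeral_2_eq_2)
qed

sublocale untwisted: poisson_ring umult ubr
  by (rule poisson_ring_untwisted)

section \<open>The induced ternary bracket\<close>

abbreviation tbr :: "'l \<Rightarrow> 'l \<Rightarrow> 'l \<Rightarrow> 'l"
  where "tbr \<equiv> induced_tbr mult br \<alpha> \<beta>"

lemma tbr_eq_triple: "tbr x y z = untwisted.triple (\<alpha> x) (\<alpha> y) (\<beta> z)"
  by (simp add: induced_tbr_def untwisted.triple_def twist \<alpha>\<beta>[symmetric] hom_untwisted numeral_2_eq_2)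

lemma hom_triple:
  "\<alpha> (untwisted.triple x y z) = untwisted.triple (\<alpha> x) (\<alpha> y) (\<alpha> z)"
  "\<beta> (untwisted.triple x y z) = untwisted.triple (\<beta> x) (\<beta> y) (\<beta> z)"
  by (simp_all add: untwisted.triple_def hom_add hom_untwisted)

lemma trilinear_tbr: "trilinear_map scale tbr"
proof -
  have mult_linear: "(x + x') \<odot> y = x \<odot> y + x' \<odot> y" "x \<odot> (y + y') = x \<odot> y + x \<odot> y'"
    "scale r x \<odot> y = scale r (x \<odot> y)" "x \<odot> scale r y = scale r (x \<odot> y)" for x x' y y' r
    by (rule bilinear_mapD[OF bilinear_mult])+
  have br_linear: "br (x + x') y = br x y + br x' y" "br x (y + y') = br x y + br x y'"
    "br (scale r x) y = scale r (br x y)" "br x (scale r y) = scale r (br x y)" for x x' y y' r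
    by (rule bilinear_mapD[OF bilinear_br])+
  show ?thesis
    unfolding trilinear_map_def Vector_Spaces.linear_iff
    by (simp add: vector_space_axioms induced_tbr_def numeral_2_eq_2 hom_add hom_scale inv_add inv_scale
        mult_linear br_linear scale_right_distrib ac_simps)
qed

theorem transposed_leibniz_tbr:
  "scale 3 (\<alpha> (\<beta> u)) \<odot> tbr x y z =
     tbr (\<beta> u \<odot> x) (\<beta> y) (\<beta> z) + tbr (\<beta> x) (\<beta> u \<odot> y) (\<beta> z)
     + tbr (\<beta> x) (\<beta> y) (\<alpha> u \<odot> z)"
proof -
  have scale_3: "scale 3 a = a + a + a" for a
  proof -
    have "scale 3 a = scale (1 + 1 + 1) a" by simp
    then show ?thesis by (simp only: scale_left_distrib scale_one)
  qed
  have "scale 3 (\<alpha> (\<beta> u)) \<odot> tbr x y z = scale 3 (\<alpha> (\<beta> u) \<odot> tbr x y z)"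
    by (simp add: bilinear_mapD[OF bilinear_mult])
  also have "\<dots> = tbr (\<beta> u \<odot> x) (\<beta> y) (\<beta> z) + tbr (\<beta> x) (\<beta> u \<odot> y) (\<beta> z)
      + tbr (\<beta> x) (\<beta> y) (\<alpha> u \<odot> z)"
    \<comment> \<open>Both sides carry the same twists: \<open>\<alpha>\<^sup>2\<beta>\<close> on \<open>u\<close>, \<open>\<alpha>\<beta>\<close> on \<open>x\<close> and \<open>y\<close>, \<open>\<beta>\<^sup>2\<close> on \<open>z\<close>.\<close>
    using untwisted.triple_transposed_leibniz[of "\<alpha> (\<alpha> (\<beta> u))" "\<alpha> (\<beta> x)" "\<alpha> (\<beta> y)" "\<beta> (\<beta> z)"]
    by (simp add: scale_3 tbr_eq_triple twist hom_triple \<alpha>\<beta> hom_untwisted)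
  finally show ?thesis .
qed

lemma transposed_if_three_bihom_lie:
  assumes "three_bihom_lie_algebra scale tbr \<alpha> \<beta>"
  shows "transposed_bihom_poisson_three_lie_algebra scale mult tbr \<alpha> \<beta>"
proof -
  interpret three_bihom_lie_algebra scale tbr \<alpha> \<beta> by fact
  show ?thesis
    by unfold_locales (rule transposed_leibniz_tbr)
qed

end

locale regular_strong_bihom_poisson_algebra =
  regular_bihom_poisson_algebra + strong_bihom_poisson_algebra
begin

sublocale untwisted: strong_poisson_ring umult ubr
proof
  fix a b c h
  obtain x y z where "a = (\<alpha> ^^ 3) ((\<beta> ^^ 3) x)" "b = (\<alpha> ^^ 3) ((\<beta> ^^ 3) y)" "c = (\<alpha> ^^ 3) ((\<beta> ^^ 3) z)"
    using ex_preimage by metis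
  moreover obtain k where "h = (\<alpha> ^^ 3) ((\<beta> ^^ 2) k)"
    using ex_preimage by metis
  ultimately show "\<lbrace>a, b\<rbrace> \<bullet> \<lbrace>h, c\<rbrace> + \<lbrace>b, c\<rbrace> \<bullet> \<lbrace>h, a\<rbrace> + \<lbrace>c, a\<rbrace> \<bullet> \<lbrace>h, b\<rbrace> = 0"
    using strong[of x y k z] by (simp add: twist \<alpha>\<beta> hom_untwisted eval_nat_numeral)
qed

theorem three_bihom_lie_tbr: "three_bihom_lie_algebra scale tbr \<alpha> \<beta>"
proof
  show "trilinear_map scale tbr"
    by (rule trilinear_tbr)
  fix x y z u v
  show "\<alpha> (tbr x y z) = tbr (\<alpha> x) (\<alpha> y) (\<alpha> z)" "\<beta> (tbr x y z) = tbr (\<beta> x) (\<beta> y) (\<beta> z)"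
    by (simp_all add: tbr_eq_triple hom_triple \<alpha>\<beta>)
  show "tbr (\<beta> x) (\<beta> y) (\<alpha> z) = - tbr (\<beta> y) (\<beta> x) (\<alpha> z)"
    unfolding tbr_eq_triple \<alpha>\<beta> by (rule untwisted.triple_skew12)
  show "tbr (\<beta> x) (\<beta> y) (\<alpha> z) = - tbr (\<beta> x) (\<beta> z) (\<alpha> y)"
    unfolding tbr_eq_triple \<alpha>\<beta> by (rule untwisted.triple_skew23)
  show "tbr ((\<beta> ^^ 2) u) ((\<beta> ^^ 2) v) (tbr (\<beta> x) (\<beta> y) (\<alpha> z)) =
         tbr ((\<beta> ^^ 2) y) ((\<beta> ^^ 2) z) (tbr (\<beta> u) (\<beta> v) (\<alpha> x))
         - tbr ((\<beta> ^^ 2) x) ((\<beta> ^^ 2) z) (tbr (\<beta> u) (\<beta> v) (\<alpha> y))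
         + tbr ((\<beta> ^^ 2) x) ((\<beta> ^^ 2) y) (tbr (\<beta> u) (\<beta> v) (\<alpha> z))"
  proof -
    \<comment> \<open>Every argument reaches the untwisted triple bracket through the same map \<open>\<alpha>\<beta>\<^sup>2\<close>, so this
      is the plain Filippov identity; the order of arguments and the minus sign come from moving
      the inner bracket to the last place.\<close>
    define u' v' x' y' z' where "u' = \<alpha> (\<beta> (\<beta> u))" "v' = \<alpha> (\<beta> (\<beta> v))"
      "x' = \<alpha> (\<beta> (\<beta> x))" "y' = \<alpha> (\<beta> (\<beta> y))" "z' = \<alpha> (\<beta> (\<beta> z))"
    note defs = this
    have "untwisted.triple u' v' (untwisted.triple x' y' z') =
        untwisted.triple y' z' (untwisted.triple u' v' x')
        - untwisted.triple x' z' (untwisted.triple u' v' y')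
        + untwisted.triple x' y' (untwisted.triple u' v' z')"
      using untwisted.triple_filippov[of u' v' x' y' z']
        untwisted.triple_cyclic[of "untwisted.triple u' v' x'" y' z']
        untwisted.triple_skew23[of x' "untwisted.triple u' v' y'" z']
      by simp
    then show ?thesis
      by (simp add: defs tbr_eq_triple hom_triple \<alpha>\<beta> numeral_2_eq_2)
  qed
qed

end

theorem theorem3p17:
  fixes scale :: "'k::field_char_0 \<Rightarrow> 'l::ab_group_add \<Rightarrow> 'l"
    and mult br :: "'l \<Rightarrow> 'l \<Rightarrow> 'l"
    and \<alpha> \<beta> :: "'l \<Rightarrow> 'l"
  assumes "regular_bihom_poisson_algebra scale mult br \<alpha> \<beta>"
  shows "(three_bihom_lie_algebra scale (induced_tbr mult br \<alpha> \<beta>) \<alpha> \<beta> \<longrightarrow>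
            transposed_bihom_poisson_three_lie_algebra scale mult (induced_tbr mult br \<alpha> \<beta>) \<alpha> \<beta>) \<and>
         (strong_bihom_poisson_algebra scale mult br \<alpha> \<beta> \<longrightarrow>
            transposed_bihom_poisson_three_lie_algebra scale mult (induced_tbr mult br \<alpha> \<beta>) \<alpha> \<beta>)"
proof (intro conjI impI)
  interpret regular_bihom_poisson_algebra scale mult br \<alpha> \<beta> by fact
  show "transposed_bihom_poisson_three_lie_algebra scale mult (induced_tbr mult br \<alpha> \<beta>) \<alpha> \<beta>"
    if "three_bihom_lie_algebra scale (induced_tbr mult br \<alpha> \<beta>) \<alpha> \<beta>"
    using that by (rule transposed_if_three_bihom_lie)
  assume "strong_bihom_poisson_algebra scale mult br \<alpha> \<beta>"
  then interpret strong: strong_bihom_poisson_algebra scale mult br \<alpha> \<beta> .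
  interpret regular_strong_bihom_poisson_algebra scale mult br \<alpha> \<beta> by unfold_locales
  show "transposed_bihom_poisson_three_lie_algebra scale mult (induced_tbr mult br \<alpha> \<beta>) \<alpha> \<beta>"
    using three_bihom_lie_tbr by (rule transposed_if_three_bihom_lie)
qed

end
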